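(* Define $IpP_1=\{2\}=pP_1$, $IpP_2=\{3\}=pP_2$, $MIpP_2=MpP_2=3$, and for $i=2,3,\ldots$ $$IpP_{i+1}=[MIpP_i+1,\;MpP_i^2],\qquad pP_{i+1}=\varphi([MIpP_i+1,\;MpP_i^2])=\varphi([MIpP_i+2,\;MpP_i^2-2]),$$ where $MIpP_i=\max IpP_i$ and $MpP_i=\max pP_i$. Then: (a) the sets $pP_j$ are $pP_1=\{2\}$, $pP_2=\{3\}$, $pP_3=\{5,7\}$, $pP_4=\{11=p_5,13,17,19,23,29,31,37,41,43,47=p_{15}\}$, $pP_5=\{53=p_{16},59=p_{17},61,\ldots,2207=p_{329}=MpP_5\}$ (all primes from $p_{16}$ to $p_{329}$), $pP_6=\{2213=p_{330},2221=p_{331},\ldots,4870843=p_{340059}\}$ (all primes from $p_{330}$ to $p_{340059}$), $\ldots$; (b) the set $\mathbb{P}$ of all prime numbers satisfies $$\mathbb{P}=\varphi(\mathbb{N})=\bigcup_{j=1}^{\infty}pP_j=pP_1\cup pP_2\cup\Big(\bigcup_{j=2}^{\infty}\varphi([MIpP_j+1,MpP_j^2])\Big)=pP_1\cup pP_2\cup\Big(\bigcup_{j=2}^{\infty}\varphi([MIpP_j+2,MpP_j^2-2])\Big)$$ $$=pP_1\cup pP_2\cup\Big(\lim_{n\to\infty}\bigcup_{j=2}^{n}\varphi([MIpP_j+2,MpP_j^2-2])\Big);$$ (c) the family $\{pP_1,pP_2,\ldots\}$ is a partition of $\mathbb{P}$.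
   Context: $\mathbb{N}=\{1,2,\ldots\}$. For $m\le n$ in $\mathbb{N}$, $[m,n]=\{k\in\mathbb{N}: m\le k\le n\}$. $p_1=2,p_2=3,\ldots$ are the primes in increasing order. For $S\subseteq\mathbb{N}$, $\varphi(S)$ is the set of all primes in $S$. The limit of an increasing sequence of sets is its union. A partition of a set is a family of non-empty, pairwise disjoint subsets whose union is the set. *)

theory Defs
  imports
    Complex_Main
    "HOL-Computational_Algebra.Primes"
    "HOL-Library.Infinite_Set"
    "HOL-Library.Disjoint_Sets"
begin

definition primes_in :: "nat set \<Rightarrow> nat set" (\<open>\<phi>\<close>) where
  "\<phi> S = {p \<in> S. prime p}"

text \<open>The primes are indexed from 1 (\<open>p\<^sub>1 = 2\<close>), whereas \<^const>\<open>enumerate\<close> starts at index 0.\<close>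
definition nth_prime :: "nat \<Rightarrow> nat" where
  "nth_prime k = enumerate {p. prime p} (k - 1)"

text \<open>Only indices from 1 on are meaningful; the value at 0 is a dummy.\<close>
fun IpP :: "nat \<Rightarrow> nat set" and pP :: "nat \<Rightarrow> nat set" where
  "IpP 0 = {}"
| "IpP (Suc 0) = {2}"
| "IpP (Suc (Suc 0)) = {3}"
| "IpP (Suc (Suc (Suc i))) = {Max (IpP (Suc (Suc i))) + 1 .. (Max (pP (Suc (Suc i))))\<^sup>2}"
| "pP 0 = {}"
| "pP (Suc 0) = {2}"
| "pP (Suc (Suc 0)) = {3}"
| "pP (Suc (Suc (Suc i))) = \<phi> {Max (IpP (Suc (Suc i))) + 1 .. (Max (pP (Suc (Suc i))))\<^sup>2}"

definition MIpP :: "nat \<Rightarrow> nat" where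
  "MIpP i = Max (IpP i)"

definition MpP :: "nat \<Rightarrow> nat" where
  "MpP i = Max (pP i)"

lemma MIpP_2: "MIpP 2 = 3" and MpP_2: "MpP 2 = 3"
  by (simp_all add: MIpP_def MpP_def numeral_2_eq_2)

lemma
  assumes "i \<ge> 2"
  shows IpP_Suc: "IpP (i + 1) = {MIpP i + 1 .. (MpP i)\<^sup>2}"
    and pP_Suc: "pP (i + 1) = \<phi> {MIpP i + 1 .. (MpP i)\<^sup>2}"
proof -
  obtain j where "i = Suc (Suc j)"
    using assms by (metis Suc_le_D numeral_2_eq_2 Suc_le_mono)
  then show "IpP (i + 1) = {MIpP i + 1 .. (MpP i)\<^sup>2}"
    and "pP (i + 1) = \<phi> {MIpP i + 1 .. (MpP i)\<^sup>2}"
    by (simp_all add: MIpP_def MpP_def)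
qed

text \<open>Used for increasing sequences of sets only (\<open>incseq\<close>).\<close>
definition set_lim :: "(nat \<Rightarrow> 'a set) \<Rightarrow> 'a set" where
  "set_lim A = (\<Union>n. A n)"

end

theory Submission
  imports Defs "HOL-Library.Code_Binary_Nat"
begin

text \<open>Every block ends in the square of a prime \<open>P\<close>, and \<open>P\<close> is the largest prime of the
  block before. So the blocks tile the integers beyond \<open>3\<close>, and each of them contains a prime as
  soon as there is always a prime between \<open>P\<close> and \<open>P\<^sup>2\<close>. The latter follows from Nair's
  bound: the least common multiple of \<open>1, \<dots>, n\<close> is at least \<open>2 ^ (n - 1)\<close>, but
  it is at most \<open>n ^ \<pi>(n)\<close>. For \<open>n = P\<^sup>2\<close>, this is impossible if all primes up to \<open>n\<close> are at
  most \<open>P\<close>.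

  The numerical values amount to \<open>\<pi>(2207\<^sup>2) = 340059\<close>. They are obtained from Legendre's
  recursion \<open>S(v, p) = S(v, p') - (S(v div p, p') - \<pi>(p'))\<close>, where \<open>p'\<close> is the prime before
  \<open>p \<le> sqrt v\<close> and \<open>S(v, p)\<close> counts the numbers from \<open>2\<close> to \<open>v\<close> that are prime or free of
  prime factors up to \<open>p\<close>.\<close>

section \<open>A prime between a prime and its square\<close>

text \<open>The recurrence \<open>1 / ((k+1) * (n choose (k+1))) = 1 / (k * ((n-1) choose k)) - 1 /
  (k * (n choose k))\<close> drives the induction: if \<open>a\<close> and \<open>b\<close> are the
  quotients of \<open>L\<close> for the two entries on the right, then \<open>a - b\<close> is the
  quotient for the entry on the left.\<close>

lemma mult_choose_dvd:
  assumes "\<And>j. 1 \<le> j \<Longrightarrow> j \<le> n \<Longrightarrow> j dvd L" and "1 \<le> k" "k \<le> n"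
  shows "k * (n choose k) dvd (L::nat)"
  using assms(2,3,1)
proof (induction k arbitrary: n rule: nat_induct_at_least)
  case base
  then show ?case by simp
next
  case (Suc k)
  obtain n' where n: "n = Suc n'"
    using Suc.prems(1) by (cases n) auto
  have "k * (n' choose k) dvd L" "k * (n choose k) dvd L"
    using Suc n by auto
  then obtain a b where a: "L = k * (n' choose k) * a" and b: "L = k * (n choose k) * b"
    by (metis dvdE)
  define c where "c = n choose Suc k"
  have 1: "Suc k * (n choose Suc k) = n * (n' choose k)"
    unfolding n by (metis Suc_times_binomial_eq mult.commute)
  have 2: "Suc k * (n choose Suc k) = (n - k) * (n choose k)"
    using Suc.prems(1) by (metis binomial_absorb_comp binomial_absorption mult.commute n diff_Suc_1 1)
  text \<open>In terms of the Leibniz harmonic triangle, whose entries are the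
    \<open>1 / (k * (n choose k))\<close>.\<close>
  have "int L * int k = int (Suc k * (n choose Suc k)) * (int a - int b) * int k"
  proof -
    \<comment> \<open>Subtracting the next equation from this one leaves
      \<open>k * L\<close>.\<close>
    have "int n * int L = int k * int a * int (Suc k * (n choose Suc k))"
      unfolding 1 by (subst a) simp
    moreover have "(int n - int k) * int L = int k * int b * int (Suc k * (n choose Suc k))"
      unfolding 2 using Suc.prems(1) by (subst b) (simp add: of_nat_diff)
    ultimately show ?thesis by (simp add: algebra_simps)
  qed
  then have "int L = int (Suc k * (n choose Suc k)) * (int a - int b)"
    using Suc.hyps by simp
  then have "int (Suc k * (n choose Suc k)) dvd int L" by simp
  then show ?case by (simp only: int_dvd_int_iff)
qed

text \<open>Since \<open>(n+1) * (n choose k) = (k+1) * ((n+1) choose (k+1))\<close>, all these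
  numbers divide \<open>L\<close>. Summing over a row of Pascal's triangle and cancelling
  \<open>n + 1\<close> gives the bound.\<close>

lemma two_power_le_common_multiple:
  assumes "\<And>j. 1 \<le> j \<Longrightarrow> j \<le> Suc n \<Longrightarrow> j dvd L" and "L > 0"
  shows "2 ^ n \<le> (L::nat)"
proof -
  have "Suc n * (n choose k) \<le> L" if "k \<le> n" for k
  proof (rule dvd_imp_le)
    show "Suc n * (n choose k) dvd L"
      using mult_choose_dvd[of "Suc n" L "Suc k"] assms that
      by (metis Suc_le_mono Suc_times_binomial_eq le_add1 mult.commute plus_1_eq_Suc)
  qed (fact assms(2))
  then have "(\<Sum>k\<le>n. Suc n * (n choose k)) \<le> (\<Sum>k\<le>n. L)"
    by (intro sum_mono) simp
  then have "Suc n * 2 ^ n \<le> Suc n * L"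
    by (simp only: choose_row_sum flip: sum_distrib_left) simp
  then show ?thesis by (simp only: Suc_mult_le_cancel1)
qed

text \<open>The least common multiple is the product of the largest prime powers not exceeding
  \<open>n\<close>. Each factor is at most \<open>n\<close>, and there is one for each prime up to
  \<open>n\<close>.\<close>

lemma obtain_common_multiple:
  obtains L :: nat where "L > 0" "\<And>j. 1 \<le> j \<Longrightarrow> j \<le> n \<Longrightarrow> j dvd L"
    "L \<le> n ^ card {p. prime p \<and> p \<le> n}"
proof -
  define e where "e p = Max {k. p ^ k \<le> n}" for p
  define L where "L = (\<Prod>p | prime p \<and> p \<le> n. p ^ e p)"
  \<comment> \<open>The exponents are bounded because \<open>k < p ^ k\<close>, so
    \<open>Max\<close> is meaningful.\<close>
  have fin: "finite {k. p ^ k \<le> n}" if "prime p" for p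
  proof (rule finite_subset)
    show "{k. p ^ k \<le> n} \<subseteq> {..n}"
      using power_gt_expt[of p] prime_gt_1_nat[OF that] by (auto intro: less_imp_le order.strict_trans2)
  qed simp
  have e: "p ^ e p \<le> n" if "prime p" "p \<le> n" for p
  proof -
    have "0 \<in> {k. p ^ k \<le> n}" using that prime_ge_1_nat[OF that(1)] by simp
    then show ?thesis using Max_in[OF fin[OF that(1)]] unfolding e_def by blast
  qed
  have "L > 0" unfolding L_def by (auto intro!: prod_pos simp: prime_gt_0_nat)
  moreover have "j dvd L" if j: "1 \<le> j" "j \<le> n" for j
  proof -
    have *: "p ^ multiplicity p j \<le> n" for p
      using j dvd_imp_le[OF multiplicity_dvd[of p j]] by linarith
    have "j = (\<Prod>p\<in>prime_factors j. p ^ multiplicity p j)"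
      using j prime_factorization_nat by simp
    also have "\<dots> dvd (\<Prod>p\<in>prime_factors j. p ^ e p)"
    proof (rule prod_dvd_prod)
      fix p assume "p \<in> prime_factors j"
      then have "prime p" by auto
      then show "p ^ multiplicity p j dvd p ^ e p"
        using * by (intro le_imp_power_dvd) (auto simp: e_def intro!: Max_ge fin)
    qed
    also have "\<dots> dvd L"
      unfolding L_def using j
      by (intro prod_dvd_prod_subset) (auto simp: prime_factors_dvd dest: dvd_imp_le)
    finally show ?thesis .
  qed
  moreover have "L \<le> (\<Prod>p | prime p \<and> p \<le> n. n)"
    unfolding L_def by (intro prod_mono) (auto intro: e)
  ultimately show ?thesis using that by simp
qed

lemma square_le_two_power:
  assumes "(4::nat) \<le> n" shows "n\<^sup>2 \<le> 2 ^ n"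
  using assms
proof (induction n rule: nat_induct_at_least)
  case (Suc n)
  have "(Suc n)\<^sup>2 \<le> 2 * n\<^sup>2"
    using Suc.hyps mult_le_mono1[of 4 n n] unfolding power2_eq_square mult_Suc mult_Suc_right by linarith
  then show ?case using Suc by simp
qed simp

lemma prime_between_square:
  assumes "prime p" obtains q :: nat where "prime q" "p < q" "q < p\<^sup>2"
\<comment> \<open>The estimate \<open>p\<^sup>2 \<le> 2 ^ p\<close> used below fails for
  \<open>p = 3\<close>.\<close>
proof (cases "p < 4")
  case True
  then have "p = 2 \<or> p = 3"
    using prime_ge_2_nat[OF assms] by auto
  then show ?thesis
    using that[of 3] that[of 5] by auto
next
  case False
  have "\<exists>q. prime q \<and> p < q \<and> q \<le> p\<^sup>2"
  proof (rule ccontr)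
    assume *: "\<not> ?thesis"
    obtain L where L: "L > 0" "\<And>j. 1 \<le> j \<Longrightarrow> j \<le> p\<^sup>2 \<Longrightarrow> j dvd L"
      "L \<le> (p\<^sup>2) ^ card {q. prime q \<and> q \<le> p\<^sup>2}"
      using obtain_common_multiple by blast
    \<comment> \<open>By assumption, all primes up to \<open>p\<^sup>2\<close> lie in
      \<open>{2..p}\<close>, so there are at most \<open>p - 1\<close> of them.\<close>
    have "card {q. prime q \<and> q \<le> p\<^sup>2} \<le> card {2..p}"
      by (intro card_mono) (use * in \<open>auto simp: prime_ge_2_nat not_le not_less\<close>)
    then have "L \<le> (p\<^sup>2) ^ (p - 1)"
      using False by (intro order.trans[OF L(3)] power_increasing) auto
    also have "\<dots> \<le> (2 ^ p) ^ (p - 1)"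
      using False by (intro power_mono square_le_two_power) auto
    also have "\<dots> = 2 ^ (p * (p - 1))"
      by (simp add: power_mult)
    also have "\<dots> < 2 ^ (p\<^sup>2 - 1)"
      using False by (intro power_strict_increasing) (cases p; simp add: power2_eq_square)+
    also have "\<dots> \<le> L"
      using L False by (intro two_power_le_common_multiple) auto
    finally show False by simp
  qed
  then obtain q where "prime q" "p < q" "q \<le> p\<^sup>2" by blast
  moreover have "\<not> prime (p\<^sup>2)" by (simp add: prime_power_iff)
  ultimately show ?thesis using that by (metis order_le_imp_less_or_eq)
qed

section \<open>Enumeration of the primes\<close>

definition prime_count :: "nat \<Rightarrow> nat" where
  "prime_count x = card {p. prime p \<and> p \<le> x}"

text \<open>\<open>enumerate\<close> is strictly increasing and onto, so the elements below the one
  at index \<open>n\<close> are those at the indices \<open>0\<close> to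
  \<open>n - 1\<close>.\<close>

lemma card_less_enumerate:
  fixes S :: "nat set"
  assumes "infinite S" shows "card {s \<in> S. s < enumerate S n} = n"
proof -
  have "{s \<in> S. s < enumerate S n} = enumerate S ` {..<n}"
  proof (intro equalityI subsetI)
    fix s assume s: "s \<in> {s \<in> S. s < enumerate S n}"
    then obtain m where "enumerate S m = s" using enumerate_Ex[OF assms] by blast
    then show "s \<in> enumerate S ` {..<n}" using s enumerate_mono_iff[OF assms] by auto
  next
    fix s assume "s \<in> enumerate S ` {..<n}"
    then show "s \<in> {s \<in> S. s < enumerate S n}"
      using enumerate_in_set[OF assms] enumerate_mono_iff[OF assms] by auto
  qed
  moreover have "inj_on (enumerate S) {..<n}"
    using strict_mono_enumerate[OF assms] by (rule strict_mono_imp_inj_on)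
  ultimately show ?thesis by (simp add: card_image)
qed

text \<open>The primes strictly below \<open>p\<close> number as many as the zero-based index of
  \<open>p\<close>; counting \<open>p\<close> itself makes up for the shift to indices from
  1.\<close>

lemma nth_prime_eqI:
  assumes "prime p" "prime_count p = k"
  shows "nth_prime k = p"
proof -
  obtain n where n: "enumerate {p. prime p} n = p"
    using enumerate_Ex[OF primes_infinite] assms(1) by auto
  have "{q. prime q \<and> q \<le> p} = insert p {q. prime q \<and> q < p}"
    using assms(1) by auto
  moreover have "card {q. prime q \<and> q < p} = n"
    using card_less_enumerate[OF primes_infinite, of n] n by simp
  ultimately have "k = Suc n"
    using assms(2) by (simp add: prime_count_def)
  then show ?thesis by (simp add: nth_prime_def n)
qed

lemma prime_nth_prime: "prime (nth_prime k)"
  using enumerate_in_set[OF primes_infinite] by (simp add: nth_prime_def)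

lemma prime_count_nth_prime:
  assumes "k \<ge> 1" shows "prime_count (nth_prime k) = k"
proof -
  define p where "p = nth_prime k"
  have "card {q. prime q \<and> q < p} = k - 1"
    using card_less_enumerate[OF primes_infinite, of "k - 1"] by (simp add: p_def nth_prime_def)
  moreover have "{q. prime q \<and> q \<le> p} = insert p {q. prime q \<and> q < p}"
    using prime_nth_prime[of k] by (auto simp: p_def)
  ultimately show ?thesis
    using assms by (simp add: prime_count_def p_def)
qed

lemma prime_count_mono: "x \<le> y \<Longrightarrow> prime_count x \<le> prime_count y"
  unfolding prime_count_def by (intro card_mono) auto

lemma prime_count_less:
  assumes "prime p" "x < p" shows "prime_count x < prime_count p"
proof -
  define A B where "A = {q. prime q \<and> q \<le> x}" and "B = {q. prime q \<and> q \<le> p}"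
  have "A \<subseteq> B" "p \<in> B" "p \<notin> A" "finite B"
    using assms by (auto simp: A_def B_def)
  then have "card A < card B" by (intro psubset_card_mono) blast+
  then show ?thesis by (simp add: prime_count_def A_def B_def)
qed

text \<open>A Galois connection, by which bounds on primes become bounds on indices.\<close>

lemma nth_prime_le_iff:
  assumes "k \<ge> 1" shows "nth_prime k \<le> x \<longleftrightarrow> k \<le> prime_count x"
  using prime_count_mono[of "nth_prime k" x] prime_count_less[OF prime_nth_prime[of k], of x]
    prime_count_nth_prime[OF assms] by linarith

text \<open>Turns an interval of values into an interval of indices, as needed for the fifth and
  sixth blocks.\<close>

lemma nth_prime_image:
  "nth_prime ` {prime_count x + 1..prime_count y} = {p. prime p \<and> x < p \<and> p \<le> y}"
proof (intro equalityI subsetI)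
  fix p assume "p \<in> nth_prime ` {prime_count x + 1..prime_count y}"
  then obtain k where "p = nth_prime k" "prime_count x < k" "k \<le> prime_count y" by auto
  then show "p \<in> {p. prime p \<and> x < p \<and> p \<le> y}"
    using nth_prime_le_iff[of k] prime_nth_prime[of k] by (auto simp flip: not_le)
next
  fix p assume "p \<in> {p. prime p \<and> x < p \<and> p \<le> y}"
  then show "p \<in> nth_prime ` {prime_count x + 1..prime_count y}"
    using prime_count_less[of p x] prime_count_mono[of p y] nth_prime_eqI[of p, OF _ refl]
    by (intro image_eqI[of _ _ "prime_count p"]) auto
qed

text \<open>In a complete increasing list, exactly the entries at positions up to \<open>i\<close>
  are at most \<open>xs ! i\<close>; positions count from 0, hence \<open>Suc i\<close>.\<close>

lemma nth_prime_nth: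
  assumes "sorted_wrt (<) xs" "set xs = {p. prime p \<and> p \<le> n}" "i < length xs"
  shows "nth_prime (Suc i) = xs ! i"
proof (rule nth_prime_eqI)
  show p: "prime (xs ! i)" using assms nth_mem by blast
  have "{q. prime q \<and> q \<le> xs ! i} = (!) xs ` {..i}"
  proof -
    have "q \<in> (!) xs ` {..i}" if "prime q" "q \<le> xs ! i" for q
    proof -
      have "q \<in> set xs" using that assms nth_mem[OF assms(3)] by auto
      then obtain j where j: "j < length xs" "q = xs ! j" by (metis in_set_conv_nth)
      then have "j \<le> i"
        using that(2) sorted_wrt_nth_less[OF assms(1), of i j] by (meson not_less)
      then show ?thesis using j by auto
    qed
    moreover have "prime (xs ! j) \<and> xs ! j \<le> xs ! i" if "j \<le> i" for j
      using assms that nth_mem[of j xs] sorted_nth_mono[of xs j i]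
      by (auto simp: strict_sorted_iff)
    ultimately show ?thesis by auto
  qed
  moreover have "inj_on ((!) xs) {..i}"
    using assms by (intro inj_on_nth) (auto simp: strict_sorted_iff)
  ultimately show "prime_count (xs ! i) = Suc i"
    by (simp add: prime_count_def card_image)
qed

section \<open>The blocks\<close>

lemma Max_atLeastAtMost: "m \<le> n \<Longrightarrow> Max {m..n} = n"
  for m n :: nat
  by (intro Max_eqI) simp_all

lemma primes_in_Icc: "\<phi> {m + 1..n} = {p. prime p \<and> m < p \<and> p \<le> n}"
  unfolding primes_in_def by auto

text \<open>The last conjunct says that no prime lies between the largest prime of a block and the
  end of the block. So the prime between \<open>MpP i\<close> and its square falls into the next
  block, which is therefore non-empty and has a maximum. Oddness serves to trim the intervals
  later.\<close>

lemma pP_invariant: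
  assumes "i \<ge> 2"
  shows "prime (MpP i) \<and> 3 \<le> MpP i \<and> MpP i \<le> MIpP i \<and> MIpP i < (MpP i)\<^sup>2 \<and> odd (MIpP i)
    \<and> (\<forall>q. prime q \<longrightarrow> MpP i < q \<longrightarrow> MIpP i < q)"
  using assms
proof (induction i rule: nat_induct_at_least)
  case base
  show ?case by (simp add: MIpP_2 MpP_2)
next
  case (Suc i)
  define P M where "P = MpP i" and "M = MIpP i"
  have IH: "prime P" "3 \<le> P" "P \<le> M" "M < P\<^sup>2" "odd M" "\<And>q. prime q \<Longrightarrow> P < q \<Longrightarrow> M < q"
    using Suc.IH by (auto simp: P_def M_def)
  have M: "MIpP (Suc i) = P\<^sup>2"
    using IpP_Suc[OF Suc.hyps] IH(4) unfolding MIpP_def[of "Suc i"] P_def M_def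
    by (simp add: Max_atLeastAtMost)
  have pP: "pP (Suc i) = {p. prime p \<and> M < p \<and> p \<le> P\<^sup>2}"
    using pP_Suc[OF Suc.hyps] unfolding primes_in_Icc P_def M_def by simp
  have fin: "finite (pP (Suc i))" unfolding pP by simp
  obtain q where "prime q" "P < q" "q < P\<^sup>2"
    using prime_between_square[OF IH(1)] by blast
  then have "q \<in> pP (Suc i)" using IH(6) by (auto simp: pP)
  then have "MpP (Suc i) \<in> pP (Suc i)"
    unfolding MpP_def using fin by (intro Max_in) auto
  then have *: "prime (MpP (Suc i))" "M < MpP (Suc i)" "MpP (Suc i) \<le> P\<^sup>2"
    by (auto simp: pP)
  have "P\<^sup>2 < q" if "prime q" "MpP (Suc i) < q" for q
  proof (rule ccontr)
    assume "\<not> P\<^sup>2 < q"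
    then have "q \<in> pP (Suc i)" using that * by (auto simp: pP)
    then have "q \<le> MpP (Suc i)" unfolding MpP_def using fin by simp
    then show False using that by simp
  qed
  \<comment> \<open>The new maximum exceeds \<open>M\<close>, and \<open>P \<le> M\<close>.\<close>
  moreover have "P\<^sup>2 < (MpP (Suc i))\<^sup>2"
    using * IH by (intro power_strict_mono) auto
  moreover have "odd (P\<^sup>2)"
    using IH(1,2) prime_odd_nat[of P] by simp
  ultimately show ?case using * IH by (auto simp: M)
qed

lemma MIpP_1: "MIpP 1 = 2"
  by (simp add: MIpP_def)

lemma MIpP_Suc: "i \<ge> 2 \<Longrightarrow> MIpP (Suc i) = (MpP i)\<^sup>2"
  using IpP_Suc[of i] pP_invariant[of i] unfolding MIpP_def[of "Suc i"]
  by (simp add: Max_atLeastAtMost)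

lemma MIpP_less_Suc:
  assumes "i \<ge> 1" shows "MIpP i < MIpP (Suc i)"
proof (cases "i = 1")
  case True
  then show ?thesis using MIpP_1 MIpP_2 by (simp add: numeral_2_eq_2)
next
  case False
  then show ?thesis using assms pP_invariant[of i] MIpP_Suc[of i] by simp
qed

lemma MIpP_mono:
  assumes "1 \<le> i" "i \<le> j" shows "MIpP i \<le> MIpP j"
  using assms(2,1)
proof (induction j rule: dec_induct)
  case (step j)
  then show ?case using MIpP_less_Suc[of j] by simp
qed simp

text \<open>The ends are unbounded, so every prime is eventually covered.\<close>

lemma MIpP_ge: "i \<ge> 1 \<Longrightarrow> i \<le> MIpP i"
proof (induction i rule: nat_induct_at_least)
  case base
  then show ?case by (simp add: MIpP_def)
next
  case (Suc i)
  then show ?case using MIpP_less_Suc[of i] by simp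
qed

text \<open>A uniform description by consecutive ends, which includes the second block although that
  one is prescribed and not computed.\<close>

lemma pP_Suc_eq:
  assumes "i \<ge> 1" shows "pP (Suc i) = {p. prime p \<and> MIpP i < p \<and> p \<le> MIpP (Suc i)}"
proof (cases "i = 1")
  case True
  have "{p. prime p \<and> 2 < p \<and> p \<le> 3} = {3::nat}" by auto
  moreover have "pP (Suc 1) = {3}" "MIpP (Suc 1) = 3"
    using MIpP_2 by (simp_all add: numeral_2_eq_2)
  ultimately show ?thesis using True MIpP_1 by simp
next
  case False
  then show ?thesis using assms pP_Suc[of i] MIpP_Suc[of i] unfolding primes_in_Icc by simp
qed

text \<open>\<open>MIpP i\<close> and \<open>MpP i\<close> are odd, so \<open>MIpP i + 1\<close> and
  \<open>(MpP i)\<^sup>2 - 1\<close> are even and exceed 2; the square itself is not prime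
  either.\<close>

lemma primes_in_trim:
  assumes "i \<ge> 2"
  shows "\<phi> {MIpP i + 1 .. (MpP i)\<^sup>2} = \<phi> {MIpP i + 2 .. (MpP i)\<^sup>2 - 2}"
proof -
  have inv: "prime (MpP i)" "3 \<le> MpP i" "MpP i \<le> MIpP i" "odd (MIpP i)"
    using pP_invariant[OF assms] by auto
  have odd: "odd (MpP i)" using inv prime_odd_nat[of "MpP i"] by simp
  have "p \<in> {MIpP i + 2 .. (MpP i)\<^sup>2 - 2}"
    if "prime p" "p \<in> {MIpP i + 1 .. (MpP i)\<^sup>2}" for p
  proof -
    have "odd p" using that inv by (intro prime_odd_nat) auto
    then have "p \<noteq> MIpP i + 1" "p \<noteq> (MpP i)\<^sup>2 - 1"
      using inv odd by auto
    moreover have "p \<noteq> (MpP i)\<^sup>2" using that(1) by (auto simp: prime_power_iff)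
    ultimately show ?thesis using that(2) by auto
  qed
  then show ?thesis by (auto simp: primes_in_def)
qed

text \<open>The block sought is the first one whose end reaches \<open>p\<close>: the preceding end
  is then below \<open>p\<close>.\<close>

lemma prime_in_pP:
  assumes "prime p" obtains i where "i \<ge> 1" "p \<in> pP i"
proof (cases "p \<le> 2")
  case True
  then have "p \<in> pP 1" using prime_ge_2_nat[OF assms] by simp
  then show ?thesis using that by blast
next
  case False
  define j where "j = (LEAST j. 1 \<le> j \<and> p \<le> MIpP j)"
  have ex: "1 \<le> p \<and> p \<le> MIpP p" using MIpP_ge[of p] False by simp
  have j: "1 \<le> j" "p \<le> MIpP j" using LeastI[of "\<lambda>j. 1 \<le> j \<and> p \<le> MIpP j", OF ex] by (auto simp: j_def)
  have "j \<noteq> 1" using j False MIpP_1 by auto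
  then obtain i where i: "j = Suc i" "1 \<le> i" using j by (cases j) auto
  have "MIpP i < p"
    using not_less_Least[of i "\<lambda>j. 1 \<le> j \<and> p \<le> MIpP j"] i by (auto simp: j_def)
  then have "p \<in> pP j" using i j assms pP_Suc_eq[of i] by auto
  then show ?thesis using that j by blast
qed

lemma prime_pP:
  assumes "i \<ge> 1" "p \<in> pP i" shows "prime p \<and> p \<le> MIpP i"
proof (cases "i = 1")
  case True then show ?thesis using assms MIpP_1 by simp
next
  case False
  then obtain j where "i = Suc j" "j \<ge> 1" using assms by (cases i) auto
  then show ?thesis using pP_Suc_eq[of j] assms by simp
qed

lemma pP_nonempty: assumes "i \<ge> 1" shows "pP i \<noteq> {}"
proof -
  consider "i = 1" | "i = 2" | j where "i = Suc j" "j \<ge> 2"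
    using assms by (cases i; cases "i = 2") (auto, force)
  then show ?thesis
  proof cases
    case 3
    obtain q where "prime q" "MpP j < q" "q < (MpP j)\<^sup>2"
      using prime_between_square pP_invariant[of j] 3 by blast
    then have "q \<in> pP (Suc j)" using pP_Suc_eq[of j] pP_invariant[of j] MIpP_Suc[of j] 3 by auto
    then show ?thesis using 3 by auto
  qed (auto simp: numeral_2_eq_2)
qed

text \<open>A later block starts beyond the end of its predecessor, hence beyond the ends of all
  earlier blocks.\<close>

lemma disjoint_pP: "disjoint_family_on pP {1..}"
proof -
  have *: "pP i \<inter> pP j = {}" if "1 \<le> i" "i < j" for i j
  proof -
    from that obtain k where k: "j = Suc k" by (cases j) auto
    have "MIpP i \<le> MIpP k" using that k by (intro MIpP_mono) auto
    then show ?thesis using prime_pP[of i] pP_Suc_eq[of k] that k by fastforce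
  qed
  show ?thesis unfolding disjoint_family_on_def
  proof (intro ballI impI)
    fix i j :: nat assume "i \<in> {1..}" "j \<in> {1..}" "i \<noteq> j"
    then show "pP i \<inter> pP j = {}" using *[of i j] *[of j i] by (cases "i < j") auto
  qed
qed

lemma UN_pP: "(\<Union>j\<in>{1..}. pP j) = {p. prime p}"
proof (intro equalityI subsetI)
  fix p assume "p \<in> {p::nat. prime p}"
  then show "p \<in> (\<Union>j\<in>{1..}. pP j)" using prime_in_pP[of p] by auto
qed (use prime_pP in auto)

lemma partition_pP: "partition_on {p. prime p} (pP ` {1..})"
  unfolding partition_on_def
proof (intro conjI)
  show "\<Union> (pP ` {1..}) = {p. prime p}" using UN_pP .
  show "disjoint (pP ` {1..})"
    using disjoint_pP by (rule disjoint_family_on_disjoint_image)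
  show "{} \<notin> pP ` {1..}" using pP_nonempty by force
qed

lemma UN_pP_split: "{p. prime p} = pP 1 \<union> pP 2 \<union> (\<Union>j\<in>{2..}. \<phi> {MIpP j + 1 .. (MpP j)\<^sup>2})"
proof -
  \<comment> \<open>The claimed union is indexed by the predecessor of each block, so the indices
    from 3 on are written as successors.\<close>
  have "n = 1 \<or> n = 2 \<or> n \<in> Suc ` {2..}" if "1 \<le> n" for n
    using that by (cases "n \<le> 2") (auto intro: image_eqI[of _ _ "n - 1"])
  then have "{1..} = insert 1 (insert 2 (Suc ` {2..}))"
    by auto
  then have "{p. prime p} = pP 1 \<union> (pP 2 \<union> (\<Union>j\<in>{2..}. pP (Suc j)))"
    by (subst UN_pP[symmetric]) (simp only: UN_insert image_image)
  also have "(\<Union>j\<in>{2..}. pP (Suc j)) = (\<Union>j\<in>{2..}. \<phi> {MIpP j + 1 .. (MpP j)\<^sup>2})"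
    by (intro SUP_cong refl) (use pP_Suc in simp)
  finally show ?thesis by (simp only: Un_assoc)
qed

section \<open>Legendre's recursion\<close>

text \<open>Any prime factor of the smaller of two proper cofactors will do.\<close>

lemma prime_divisor_le_sqrt:
  fixes n :: nat
  assumes "\<not> prime n" "2 \<le> n"
  obtains q where "prime q" "q dvd n" "q * q \<le> n"
proof -
  obtain a where "a dvd n" "a \<noteq> 1" "a \<noteq> n"
    using assms by (auto simp: prime_nat_iff)
  then obtain b where "n = a * b" "b \<noteq> 1" by (auto elim: dvdE)
  then have ab: "n = a * b" "1 < a" "1 < b"
    using assms(2) \<open>a \<noteq> 1\<close> by (cases a; cases b; force)+
  have "min a b \<noteq> 1" using ab by (simp add: min_def)
  then obtain q where q: "prime q" "q dvd min a b" using prime_factor_nat by blast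
  then have "q \<le> min a b" using ab by (intro dvd_imp_le) auto
  then have "q * q \<le> n" unfolding ab(1) by (intro mult_le_mono) auto
  moreover have "q dvd n" using q(2) ab(1) by (auto simp: min_def split: if_splits)
  ultimately show ?thesis using that q(1) by blast
qed

text \<open>This is the set counted by \<open>S(v, p)\<close>, with \<open>ps\<close> the odd primes
  up to \<open>p\<close>. The prime 2 is built in as oddness, so the recursion can stop at a closed
  formula.\<close>

definition sift :: "nat list \<Rightarrow> nat \<Rightarrow> nat set" where
  "sift ps v = {n \<in> {2..v}. prime n \<or> odd n \<and> (\<forall>q\<in>set ps. \<not> q dvd n)}"

text \<open>The order is descending: the head is the prime to split off, and the tail consists of
  all smaller odd primes.\<close>

definition odd_primes_below :: "nat \<Rightarrow> nat list \<Rightarrow> bool" where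
  "odd_primes_below b ps \<longleftrightarrow> sorted_wrt (>) ps \<and> set ps = {q. prime q \<and> odd q \<and> q < b}"

lemma odd_primes_below_ConsD:
  assumes "odd_primes_below b (p # ps)"
  shows "prime p" "odd p" "odd_primes_below p ps"
proof -
  have s: "sorted_wrt (>) ps" "\<forall>q\<in>set ps. q < p" "insert p (set ps) = {q. prime q \<and> odd q \<and> q < b}"
    using assms by (auto simp: odd_primes_below_def)
  then show "prime p" "odd p" by blast+
  have "p < b" using s(3) by blast
  have "q \<in> set ps \<longleftrightarrow> prime q \<and> odd q \<and> q < p" for q
  proof
    assume "q \<in> set ps"
    then show "prime q \<and> odd q \<and> q < p" using s(2,3) by blast
  next
    assume "prime q \<and> odd q \<and> q < p"
    then have "q \<in> insert p (set ps)" "q \<noteq> p" using s(3) \<open>p < b\<close> by auto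
    then show "q \<in> set ps" by blast
  qed
  then show "odd_primes_below p ps" using s(1) by (auto simp: odd_primes_below_def)
qed

lemma card_sift_Nil:
  assumes "2 \<le> v" shows "card (sift [] v) = (v + 1) div 2"
proof -
  have "sift [] v = insert 2 ((\<lambda>k. 2 * k + 1) ` {1..<(v + 1) div 2})"
  proof (intro equalityI subsetI)
    fix n assume "n \<in> sift [] v"
    then have n: "2 \<le> n" "n \<le> v" "n = 2 \<or> odd n"
      using prime_odd_nat[of n] by (auto simp: sift_def)
    show "n \<in> insert 2 ((\<lambda>k. 2 * k + 1) ` {1..<(v + 1) div 2})"
    proof (cases "n = 2")
      case False
      with n obtain k where "n = 2 * k + 1" by (auto elim: oddE)
      then show ?thesis using n by auto
    qed simp
  qed (use assms in \<open>auto simp: sift_def\<close>)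
  moreover have "inj_on (\<lambda>k::nat. 2 * k + 1) {1..<(v + 1) div 2}" by (auto intro: inj_onI)
  moreover have "2 \<notin> (\<lambda>k::nat. 2 * k + 1) ` {1..<(v + 1) div 2}" by (rule notI, erule imageE, presburger)
  ultimately have "card (sift [] v) = Suc ((v + 1) div 2 - 1)" by (simp add: card_image)
  then show ?thesis using assms by simp
qed

text \<open>The numbers removed on account of \<open>p\<close> are the \<open>p * m\<close> with
  \<open>m \<in> R\<close>. On the other hand, \<open>sift ps (v div p)\<close> consists of
  \<open>R\<close> and the \<open>length ps + 1\<close> primes below \<open>p\<close>. Both sides
  are sums to avoid truncated subtraction.\<close>

lemma card_sift_Cons:
  assumes ps: "odd_primes_below b (p # ps)" and v: "p * p \<le> v"
  shows "card (sift (p # ps) v) + card (sift ps (v div p)) = card (sift ps v) + (length ps + 1)"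
proof -
  note p = odd_primes_below_ConsD[OF ps]
  have set_ps: "set ps = {q. prime q \<and> odd q \<and> q < p}"
    using p(3) by (simp add: odd_primes_below_def)
  have p0: "p > 2" using p(1,2) prime_ge_2_nat[of p] by (cases "p = 2") auto
  \<comment> \<open>This ensures that all primes below \<open>p\<close> are within the range of
    \<open>sift ps (v div p)\<close>.\<close>
  have vp: "p \<le> v div p" using v p0 by (simp add: less_eq_div_iff_mult_less_eq)
  define R where "R = {m \<in> {2..v div p}. odd m \<and> (\<forall>q\<in>set ps. \<not> q dvd m)}"
  have dvd_p: "\<not> q dvd p" if "q \<in> set ps" for q
    using that p(1) by (auto simp: set_ps dest: primes_dvd_imp_eq)
  have "sift ps v = sift (p # ps) v \<union> (*) p ` R"
  proof (intro equalityI subsetI)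
    fix n assume n: "n \<in> sift ps v"
    show "n \<in> sift (p # ps) v \<union> (*) p ` R"
    proof (cases "prime n \<or> \<not> p dvd n")
      case True
      then show ?thesis using n by (auto simp: sift_def)
    next
      case False
      then obtain m where m: "n = p * m" "\<not> prime n" by (auto elim: dvdE)
      have "m \<noteq> 0" "m \<noteq> 1" using m n p(1) by (auto simp: sift_def)
      then have "m \<in> R" using n m p0
        by (auto simp: R_def sift_def less_eq_div_iff_mult_less_eq mult.commute)
      then show ?thesis using m by blast
    qed
  next
    fix n assume "n \<in> sift (p # ps) v \<union> (*) p ` R"
    then show "n \<in> sift ps v"
    proof
      assume "n \<in> (*) p ` R"
      then obtain m where m: "n = p * m" "m \<in> R" by blast
      have "n \<le> v" using m p0 by (auto simp: R_def less_eq_div_iff_mult_less_eq mult.commute)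
      moreover have "2 \<le> n" using m p0 mult_le_mono[of 1 p 2 m] by (auto simp: R_def)
      moreover have "\<not> q dvd n" if "q \<in> set ps" for q
        using that m dvd_p[OF that] by (auto simp: R_def set_ps prime_dvd_mult_iff)
      ultimately show ?thesis using m p(2) by (auto simp: sift_def R_def)
    qed (auto simp: sift_def)
  qed
  moreover have "sift (p # ps) v \<inter> (*) p ` R = {}"
  proof -
    have "p * m \<notin> sift (p # ps) v" if "m \<in> R" for m
    proof -
      have "\<not> prime (p * m)" using prime_product[of p m] that p0 by (auto simp: R_def)
      then show ?thesis by (simp add: sift_def)
    qed
    then show ?thesis by blast
  qed
  moreover have fin: "finite (sift qs w)" for qs w by (simp add: sift_def)
  have "finite R" by (simp add: R_def)
  moreover have "inj_on ((*) p) R" using p0 by (auto intro: inj_onI)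
  ultimately have 1: "card (sift ps v) = card (sift (p # ps) v) + card R"
    using fin by (simp add: card_Un_disjoint card_image)
  have "sift ps (v div p) = insert 2 (set ps) \<union> R"
  proof (intro equalityI subsetI)
    fix m assume "m \<in> sift ps (v div p)"
    then show "m \<in> insert 2 (set ps) \<union> R"
      using prime_odd_nat[of m] primes_dvd_imp_eq[of _ m] unfolding sift_def R_def set_ps by auto
  next
    fix m assume "m \<in> insert 2 (set ps) \<union> R"
    then show "m \<in> sift ps (v div p)"
      using vp p0 prime_ge_2_nat[of m] by (auto simp: sift_def R_def set_ps)
  qed
  moreover have "insert 2 (set ps) \<inter> R = {}" by (auto simp: R_def)
  moreover have "card (insert 2 (set ps)) = length ps + 1"
  proof -
    have "distinct ps"
      using p(3) strict_sorted_iff[of "rev ps"] by (simp add: odd_primes_below_def sorted_wrt_rev)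
    moreover have "2 \<notin> set ps" by (simp add: set_ps)
    ultimately show ?thesis by (simp add: distinct_card)
  qed
  ultimately have 2: "card (sift ps (v div p)) = length ps + 1 + card R"
    using \<open>finite R\<close> card_Un_disjoint[of "insert 2 (set ps)" R]
    by (simp only: finite_insert List.finite_set)
  show ?thesis using 1 2 by simp
qed

text \<open>If \<open>p * m\<close> passes the smaller primes and \<open>m < p\<close>, then
  \<open>m\<close> has no prime factor left, so \<open>m = 1\<close> and the number is
  \<open>p\<close> itself, which is kept.\<close>

lemma sift_Cons_small:
  assumes ps: "odd_primes_below b (p # ps)" and v: "v < p * p"
  shows "sift (p # ps) v = sift ps v"
proof -
  note p = odd_primes_below_ConsD[OF ps]
  have set_ps: "set ps = {q. prime q \<and> odd q \<and> q < p}"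
    using p(3) by (simp add: odd_primes_below_def)
  have "prime n" if n: "n \<le> v" "odd n" "\<forall>q\<in>set ps. \<not> q dvd n" "p dvd n" "2 \<le> n" for n
  proof -
    obtain m where m: "n = p * m" using \<open>p dvd n\<close> by (auto elim: dvdE)
    have "m < p" using m n(1) v by (metis leD le_less_trans mult_le_mono2 not_less)
    have "m = 1"
    proof (rule ccontr)
      assume "m \<noteq> 1"
      then obtain q where q: "prime q" "q dvd m" using prime_factor_nat by blast
      have "m > 0" using m n(5) by (cases m) auto
      then have "q < p" using dvd_imp_le[OF q(2)] \<open>m < p\<close> by simp
      moreover have "odd q" using q(2) m n(2) by auto
      ultimately show False using n(3) m q by (auto simp: set_ps)
    qed
    then show ?thesis using m p(1) by simp
  qed
  then show ?thesis by (auto simp: sift_def)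
qed

text \<open>An odd composite number below \<open>b * b\<close> has an odd prime factor below
  \<open>b\<close>, so only primes survive.\<close>

lemma card_sift_eq_prime_count:
  assumes ps: "odd_primes_below b ps" and v: "v < b * b"
  shows "card (sift ps v) = prime_count v"
proof -
  have "prime n" if n: "n \<le> v" "odd n" "\<forall>q\<in>set ps. \<not> q dvd n" "2 \<le> n" for n
  proof (rule ccontr)
    assume "\<not> prime n"
    then obtain q where q: "prime q" "q dvd n" "q * q \<le> n"
      using n(4) by (rule prime_divisor_le_sqrt)
    then have "q < b" using n(1) v by (meson le_less_trans mult_le_mono not_less)
    moreover have "odd q" using q(2) n(2) dvd_trans by blast
    ultimately have "q \<in> set ps" using q(1) ps by (simp add: odd_primes_below_def)
    then show False using n(3) q by blast
  qed
  then have "sift ps v = {p. prime p \<and> p \<le> v}"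
    by (auto simp: sift_def prime_ge_2_nat)
  then show ?thesis by (simp add: prime_count_def)
qed

section \<open>Evaluation in binary\<close>

text \<open>Binary digits with the least significant one outermost. Leading zeros are possible, so
  correctness is always stated through \<open>val\<close>.\<close>

datatype bits = Nil0 | B0 bits | B1 bits

fun val :: "bits \<Rightarrow> nat" where
  "val Nil0 = 0"
| "val (B0 a) = 2 * val a"
| "val (B1 a) = 2 * val a + 1"

fun bits_of_num :: "num \<Rightarrow> bits" where
  "bits_of_num num.One = B1 Nil0"
| "bits_of_num (num.Bit0 n) = B0 (bits_of_num n)"
| "bits_of_num (num.Bit1 n) = B1 (bits_of_num n)"

definition bits_of :: "nat \<Rightarrow> bits" where
  "bits_of n = (if n = 0 then Nil0 else bits_of_num (num_of_nat n))"

lemma val_bits_of_num: "val (bits_of_num n) = numeral n"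
  by (induction n) (simp_all add: numeral_Bit0 numeral_Bit1)

lemma val_bits_of [simp]: "val (bits_of n) = n"
  by (simp add: bits_of_def val_bits_of_num numeral_num_of_nat)

text \<open>The case of \<open>Nil0\<close> keeps doubling from producing the leading zero
  \<open>B0 Nil0\<close>.\<close>

fun dbl :: "bits \<Rightarrow> bits" where
  "dbl Nil0 = Nil0"
| "dbl (B0 a) = B0 (B0 a)"
| "dbl (B1 a) = B0 (B1 a)"

lemma val_dbl [simp]: "val (dbl a) = 2 * val a"
  by (cases a) simp_all

fun inc :: "bits \<Rightarrow> bits" where
  "inc Nil0 = B1 Nil0"
| "inc (B0 a) = B1 a"
| "inc (B1 a) = B0 (inc a)"

lemma val_inc [simp]: "val (inc a) = val a + 1"
  by (induction a) simp_all

fun dec :: "bits \<Rightarrow> bits" where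
  "dec Nil0 = Nil0"
| "dec (B0 a) = B1 (dec a)"
| "dec (B1 a) = dbl a"

lemma val_dec [simp]: "0 < val a \<Longrightarrow> val (dec a) = val a - 1"
  by (induction a) auto

fun add :: "bits \<Rightarrow> bits \<Rightarrow> bits" where
  "add Nil0 b = b"
| "add a Nil0 = a"
| "add (B0 a) (B0 b) = B0 (add a b)"
| "add (B0 a) (B1 b) = B1 (add a b)"
| "add (B1 a) (B0 b) = B1 (add a b)"
| "add (B1 a) (B1 b) = B0 (inc (add a b))"

lemma val_add [simp]: "val (add a b) = val a + val b"
  by (induction a b rule: add.induct) simp_all

fun mul :: "bits \<Rightarrow> bits \<Rightarrow> bits" where
  "mul Nil0 b = Nil0"
| "mul (B0 a) b = dbl (mul a b)"
| "mul (B1 a) b = add b (dbl (mul a b))"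

lemma val_mul [simp]: "val (mul a b) = val a * val b"
  by (induction a b rule: mul.induct) (simp_all add: algebra_simps)

text \<open>The flag is the answer when both numbers are equal; it carries the comparison of the
  lower digits.\<close>
fun cmp :: "bool \<Rightarrow> bits \<Rightarrow> bits \<Rightarrow> bool" where
  "cmp c Nil0 Nil0 = c"
| "cmp c Nil0 (B0 b) = cmp c Nil0 b"
| "cmp c Nil0 (B1 b) = True"
| "cmp c (B0 a) Nil0 = cmp c a Nil0"
| "cmp c (B1 a) Nil0 = False"
| "cmp c (B0 a) (B0 b) = cmp c a b"
| "cmp c (B1 a) (B1 b) = cmp c a b"
| "cmp c (B0 a) (B1 b) = cmp True a b"
| "cmp c (B1 a) (B0 b) = cmp False a b"

lemma cmp_iff: "cmp c a b \<longleftrightarrow> val a < val b \<or> c \<and> val a = val b"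
  by (induction c a b rule: cmp.induct) auto

text \<open>The flag is a borrow.\<close>
fun sub :: "bool \<Rightarrow> bits \<Rightarrow> bits \<Rightarrow> bits" where
  "sub False a Nil0 = a"
| "sub True a Nil0 = dec a"
| "sub c Nil0 b = Nil0"
| "sub False (B0 a) (B0 b) = dbl (sub False a b)"
| "sub False (B1 a) (B1 b) = dbl (sub False a b)"
| "sub False (B1 a) (B0 b) = B1 (sub False a b)"
| "sub False (B0 a) (B1 b) = B1 (sub True a b)"
| "sub True (B0 a) (B0 b) = B1 (sub True a b)"
| "sub True (B1 a) (B1 b) = B1 (sub True a b)"
| "sub True (B1 a) (B0 b) = dbl (sub False a b)"
| "sub True (B0 a) (B1 b) = dbl (sub True a b)"

lemma val_sub: "val b + of_bool c \<le> val a \<Longrightarrow> val (sub c a b) = val a - (val b + of_bool c)"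
  by (induction c a b rule: sub.induct) auto

text \<open>Here and below, conditionals are matched by auxiliary functions: after contracting an
  \<open>if\<close> or \<open>case\<close>, the simplifier visits all arguments once more, which makes the evaluation
  with large tables several times slower.\<close>
fun divmod_step2 :: "bool \<Rightarrow> bits \<Rightarrow> bits \<Rightarrow> bits \<Rightarrow> bits \<times> bits" where
  "divmod_step2 True p q r = (B1 q, sub False r p)"
| "divmod_step2 False p q r = (dbl q, r)"

definition divmod_step1 :: "bits \<Rightarrow> bits \<Rightarrow> bits \<Rightarrow> bits \<times> bits" where
  "divmod_step1 p q r = divmod_step2 (cmp True p r) p q r"

fun divmod_step :: "bool \<Rightarrow> bits \<Rightarrow> bits \<times> bits \<Rightarrow> bits \<times> bits" where
  "divmod_step False p (q, r) = divmod_step1 p q (dbl r)"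
| "divmod_step True p (q, r) = divmod_step1 p q (B1 r)"

text \<open>Schoolbook division from the leading digit down. A remainder below \<open>p\<close>
  extended by one digit stays below \<open>2 * p\<close>, so a single conditional subtraction yields
  the next digit of the quotient.\<close>

fun long_div :: "bits \<Rightarrow> bits \<Rightarrow> bits \<times> bits" where
  "long_div p Nil0 = (Nil0, Nil0)"
| "long_div p (B0 v) = divmod_step False p (long_div p v)"
| "long_div p (B1 v) = divmod_step True p (long_div p v)"

lemma divmod_step:
  assumes "val r < val p" "divmod_step b p (q, r) = (q', r')"
  shows "val q' * val p + val r' = 2 * (val q * val p + val r) + of_bool b \<and> val r' < val p"
proof -
  define s where "s = (if b then B1 r else dbl r)"
  have s: "val s = 2 * val r + of_bool b" "divmod_step2 (cmp True p s) p q s = (q', r')"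
    using assms(2) by (cases b; simp add: s_def divmod_step1_def)+
  show ?thesis
  proof (cases "val p \<le> val s")
    case True
    then have "q' = B1 q" "val r' = val s - val p"
      using s(2) val_sub[of p False s] by (auto simp: cmp_iff le_less)
    then show ?thesis using True s(1) assms(1) by (auto simp: algebra_simps)
  next
    case False
    then show ?thesis using s by (auto simp: cmp_iff algebra_simps)
  qed
qed

lemma long_div_aux:
  assumes "0 < val p" "long_div p v = (q, r)"
  shows "val q * val p + val r = val v \<and> val r < val p"
  using assms(2)
proof (induction v arbitrary: q r)
  case Nil0
  then show ?case using assms(1) by auto
next
  case (B0 v)
  then show ?case
    using divmod_step[of _ p False _ q r] by (cases "long_div p v") fastforce
next
  case (B1 v)
  then show ?case
    using divmod_step[of _ p True _ q r] by (cases "long_div p v") fastforce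
qed

lemma long_div:
  assumes "0 < val p" "long_div p v = (q, r)"
  shows "val q = val v div val p" "val r = val v mod val p"
proof -
  have "val v = val q * val p + val r" "val r < val p" using long_div_aux[OF assms] by auto
  then show "val q = val v div val p" "val r = val v mod val p" by auto
qed

text \<open>Rounds up, to match the count in \<open>card_sift_Nil\<close>.\<close>

fun half :: "bits \<Rightarrow> bits" where
  "half Nil0 = Nil0"
| "half (B0 a) = a"
| "half (B1 a) = inc a"

lemma val_half [simp]: "val (half a) = (val a + 1) div 2"
  by (cases a) auto

section \<open>Primality by trial division\<close>

fun is_zero :: "bits \<Rightarrow> bool" where
  "is_zero Nil0 = True"
| "is_zero (B0 a) = is_zero a"
| "is_zero (B1 a) = False"

lemma is_zero_iff: "is_zero a \<longleftrightarrow> val a = 0"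
  by (induction a) auto

text \<open>Zero remainder with quotient \<open>1\<close> is not a proper factorisation.\<close>
fun no_factor2 :: "bool \<Rightarrow> bits \<Rightarrow> bool" where
  "no_factor2 False q = True"
| "no_factor2 True q = cmp True q (B1 Nil0)"

fun no_factor1 :: "bits \<times> bits \<Rightarrow> bool" where
  "no_factor1 (q, r) = no_factor2 (is_zero r) q"

fun trial :: "bits list \<Rightarrow> bits \<Rightarrow> bool" and trial1 :: "bool \<Rightarrow> bits list \<Rightarrow> bits \<Rightarrow> bool" where
  "trial [] n = True"
| "trial (p # ps) n = trial1 (no_factor1 (long_div p n)) ps n"
| "trial1 True ps n = trial ps n"
| "trial1 False ps n = False"

text \<open>When the remainder is zero, the quotient is at most 1 just for \<open>p = n\<close>. So
  the number under test may itself occur among the divisors.\<close>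

lemma no_factor1_long_div:
  assumes "2 \<le> val p" "2 \<le> val n"
  shows "no_factor1 (long_div p n) \<longleftrightarrow> \<not> (val p dvd val n \<and> val p \<noteq> val n)"
proof -
  obtain q r where qr: "long_div p n = (q, r)" by force
  then have "val q = val n div val p" "val r = val n mod val p"
    using long_div[of p n q r] assms by auto
  moreover have "val n div val p \<le> 1 \<longleftrightarrow> val p = val n" if "val p dvd val n"
  proof -
    from that obtain k where k: "val n = val p * k" by (rule dvdE)
    have "k \<noteq> 0" using k assms(2) by (intro notI) simp
    then show ?thesis using k assms(1) by (cases "k = 1") auto
  qed
  ultimately show ?thesis
    by (cases "is_zero r") (auto simp: qr cmp_iff is_zero_iff le_less dvd_eq_mod_eq_0)
qed

lemma trial_iff:
  assumes "2 \<le> val n" "\<forall>p\<in>set ps. 2 \<le> val p"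
  shows "trial ps n \<longleftrightarrow> (\<forall>p\<in>set ps. val p dvd val n \<longrightarrow> val p = val n)"
  using assms(2)
proof (induction ps)
  case (Cons p ps)
  then show ?case
    using no_factor1_long_div[of p n] assms(1) by (cases "no_factor1 (long_div p n)") auto
qed simp

text \<open>A composite number is caught by its prime factor up to the square root, and a prime has
  no divisor from 2 on but itself. The list may also contain composite numbers, as in the first
  round of sieving.\<close>

lemma trial_iff_prime:
  assumes "2 \<le> val n" "\<forall>p\<in>set ps. 2 \<le> val p"
    and "\<And>q. prime q \<Longrightarrow> q * q \<le> val n \<Longrightarrow> q \<in> val ` set ps"
  shows "trial ps n \<longleftrightarrow> prime (val n)"
proof
  assume trial: "trial ps n"
  show "prime (val n)"
  proof (rule ccontr)
    assume *: "\<not> prime (val n)"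
    obtain q where q: "prime q" "q dvd val n" "q * q \<le> val n"
      using prime_divisor_le_sqrt[OF * assms(1)] by blast
    then have "q = val n"
      using assms trial by (auto simp: trial_iff)
    then show False using q * by simp
  qed
next
  assume prime: "prime (val n)"
  have "val p = val n" if "p \<in> set ps" "val p dvd val n" for p
  proof -
    have "val p = 1 \<or> val p = val n" using prime that(2) prime_nat_iff by blast
    moreover have "2 \<le> val p" using assms(2) that(1) by blast
    ultimately show ?thesis by linarith
  qed
  then show "trial ps n" using assms(1,2) trial_iff by blast
qed

fun keep_if :: "bool \<Rightarrow> 'a \<Rightarrow> 'a list \<Rightarrow> 'a list" where
  "keep_if True x xs = x # xs"
| "keep_if False x xs = xs"

fun primes_among :: "bits list \<Rightarrow> bits list \<Rightarrow> bits list" where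
  "primes_among ps [] = []"
| "primes_among ps (n # ns) = keep_if (trial ps n) n (primes_among ps ns)"

lemma primes_among:
  assumes "\<forall>n\<in>set ns. 2 \<le> val n" "\<forall>p\<in>set ps. 2 \<le> val p"
    and "\<And>q n. n \<in> set ns \<Longrightarrow> prime q \<Longrightarrow> q * q \<le> val n \<Longrightarrow> q \<in> val ` set ps"
  shows "map val (primes_among ps ns) = filter prime (map val ns)"
  using assms(1,3)
proof (induction ns)
  case (Cons n ns)
  have "trial ps n \<longleftrightarrow> prime (val n)"
    using Cons.prems assms(2) by (intro trial_iff_prime) auto
  then show ?case using Cons by (cases "trial ps n") auto
qed simp

section \<open>Legendre's recursion on a table of primes\<close>

fun swap_pair :: "'a \<times> 'a \<Rightarrow> 'a \<times> 'a" where
  "swap_pair (a, b) = (b, a)"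

text \<open>A table row holds a prime, its square, and the number of smaller primes. The terms of the
  alternating sum with positive and negative sign are collected in the accumulators \<open>a\<close> and
  \<open>b\<close>, which exchange their roles in the subtracted call.\<close>
function (sequential) legendre :: "(bits \<times> bits \<times> bits) list \<Rightarrow> bits \<Rightarrow> bits \<Rightarrow> bits \<Rightarrow> bits \<times> bits"
  and legendre1 :: "bool \<Rightarrow> bits \<Rightarrow> bits \<Rightarrow> (bits \<times> bits \<times> bits) list \<Rightarrow> bits \<Rightarrow> bits \<Rightarrow> bits
    \<Rightarrow> bits \<times> bits"
  and legendre2 :: "bits \<times> bits \<Rightarrow> bits \<Rightarrow> (bits \<times> bits \<times> bits) list \<Rightarrow> bits \<times> bits
    \<Rightarrow> bits \<times> bits" where
  "legendre [] v a b = (add (half v) a, b)"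
| "legendre ((p, q, k) # t) v a b = legendre1 (cmp True q v) p k t v a b"
| "legendre1 False p k t v a b = legendre t v a b"
| "legendre1 True p k t v a b = legendre2 (legendre t v a b) k t (long_div p v)"
| "legendre2 (a, b) k t (v, r) = swap_pair (legendre t v b (add k a))"
  by pat_completeness auto
termination
  by (relation "measure (case_sum (\<lambda>(t, _). 3 * length t)
    (case_sum (\<lambda>(_, _, _, t, _). 3 * length t + 2) (\<lambda>(_, _, t, _). 3 * length t + 1)))") auto

text \<open>Reverses an increasing list, so that the largest prime heads the table.\<close>

fun rows :: "bits \<Rightarrow> bits list \<Rightarrow> (bits \<times> bits \<times> bits) list \<Rightarrow> (bits \<times> bits \<times> bits) list" where
  "rows k [] t = t"
| "rows k (p # ps) t = rows (inc k) ps ((p, mul p p, k) # t)"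

text \<open>The \<open>+ 1\<close> accounts for the prime 2, which is not in the table.\<close>

fun is_table :: "nat list \<Rightarrow> (bits \<times> bits \<times> bits) list \<Rightarrow> bool" where
  "is_table [] [] = True"
| "is_table (n # ns) ((p, q, k) # t)
    \<longleftrightarrow> val p = n \<and> val q = n * n \<and> val k = length ns + 1 \<and> is_table ns t"
| "is_table _ _ = False"

lemma is_table_rows:
  "is_table ns t \<Longrightarrow> val k = length ns + 1 \<Longrightarrow> is_table (rev (map val ps) @ ns) (rows k ps t)"
proof (induction ps arbitrary: k ns t)
  case (Cons p ps)
  show ?case
    using Cons.IH[of "val p # ns" "(p, mul p p, k) # t" "inc k"] Cons.prems by simp
qed simp

text \<open>The difference of the accumulators grows by the count; it is stated with sums because
  the difference may be negative on the way. The second recursive call runs with exchanged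
  accumulators, so its count enters with a minus sign and \<open>k\<close> with a plus sign.\<close>

lemma legendre_correct:
  assumes "is_table ns t" "odd_primes_below b ns" "2 \<le> val v" "legendre t v x y = (x', y')"
  shows "val x' + val y = val x + val y' + card (sift ns (val v))"
  using assms
proof (induction ns arbitrary: b t v x y x' y')
  case Nil
  then have "t = []" by (cases t) auto
  then show ?case using Nil by (auto simp: card_sift_Nil)
next
  case (Cons n ns)
  obtain p q k t' where t: "t = (p, q, k) # t'"
    using Cons.prems(1) by (cases t) auto
  have pqk: "val p = n" "val q = n * n" "val k = length ns + 1" and t': "is_table ns t'"
    using Cons.prems(1) by (auto simp: t)
  note n = odd_primes_below_ConsD[OF Cons.prems(2)]
  show ?case
  proof (cases "n * n \<le> val v")
    case False
    have "\<not> cmp True q v" using False by (auto simp: cmp_iff pqk)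
    then have "legendre t' v x y = (x', y')" using Cons.prems(4) by (simp add: t)
    from Cons.IH[OF t' n(3) Cons.prems(3) this] show ?thesis
      using sift_Cons_small[OF Cons.prems(2), of "val v"] False by simp
  next
    case True
    obtain x1 y1 where 1: "legendre t' v x y = (x1, y1)" by force
    obtain w r where w: "long_div p v = (w, r)" by force
    obtain x2 y2 where 2: "legendre t' w y1 (add k x1) = (x2, y2)" by force
    have n2: "2 \<le> n" using n(1) by (rule prime_ge_2_nat)
    have val_w: "val w = val v div n" using long_div[OF _ w] n2 pqk by simp
    \<comment> \<open>The quotient is again at least 2, as the induction hypothesis
      requires.\<close>
    have "n \<le> val v div n" using True n2 by (simp add: less_eq_div_iff_mult_less_eq)
    then have w2: "2 \<le> val w" using n2 val_w by simp
    have "cmp True q v" using True by (auto simp: cmp_iff pqk)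
    then have xy: "x' = y2" "y' = x2" using Cons.prems(4) 1 2 w by (simp_all add: t)
    show ?thesis
      using Cons.IH[OF t' n(3) Cons.prems(3) 1] Cons.IH[OF t' n(3) w2 2]
        card_sift_Cons[OF Cons.prems(2) True] xy pqk(3) val_w
      by simp
  qed
qed

section \<open>The primes up to 2221 in two rounds of sieving\<close>

definition primes_49 :: "bits list" where
  "primes_49 = primes_among (map bits_of [2..<Suc 7]) (map bits_of [2..<Suc 49])"

text \<open>Divisors up to 49 suffice because \<open>2221 < 50 * 50\<close>. The bound is the
  largest prime needed among the stated small values, and it exceeds 2207, the square root of
  4870849.\<close>

definition primes_2221 :: "bits list" where
  "primes_2221 = primes_among primes_49 (map bits_of [2..<Suc 2221])"

lemma map_val_map_bits_of [simp]: "map val (map bits_of ns) = ns"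
  by (induction ns) simp_all

lemma set_filter_prime: "set (filter prime [2..<Suc n]) = {p. prime p \<and> p \<le> n}"
  by (auto dest: prime_ge_2_nat)

text \<open>Below \<open>Suc b * Suc b\<close>, a prime whose square is at most the tested number is
  at most \<open>b\<close>.\<close>

lemma map_val_primes_among:
  assumes "val ` set ps \<subseteq> {2..}" "\<And>p. prime p \<Longrightarrow> p \<le> b \<Longrightarrow> p \<in> val ` set ps"
    and "\<And>n. n \<in> set ns \<Longrightarrow> 2 \<le> n \<and> n < Suc b * Suc b"
  shows "map val (primes_among ps (map bits_of ns)) = filter prime ns"
proof -
  have "q \<in> val ` set ps" if "n \<in> set ns" "prime q" "q * q \<le> n" for n q
  proof (rule assms(2))
    show "q \<le> b"
    proof (rule ccontr)
      assume "\<not> q \<le> b"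
      then have "Suc b * Suc b \<le> q * q" by (intro mult_le_mono) auto
      then show False using that assms(3)[of n] by linarith
    qed
  qed (fact that)
  then have "map val (primes_among ps (map bits_of ns)) = filter prime (map val (map bits_of ns))"
    using assms(1,3) by (intro primes_among) auto
  then show ?thesis by (simp only: map_val_map_bits_of)
qed

lemma set_primes_49: "val ` set primes_49 = {p. prime p \<and> p \<le> 49}"
proof -
  have "map val primes_49 = filter prime [2..<Suc 49]"
    unfolding primes_49_def
  proof (rule map_val_primes_among[where b = 7])
    show "p \<in> val ` set (map bits_of [2..<Suc 7])" if "prime p" "p \<le> 7" for p
    proof -
      have "p \<in> set [2..<Suc 7]" using that prime_ge_2_nat[of p] by (simp only: set_upt) simp
      then have "val (bits_of p) \<in> val ` set (map bits_of [2..<Suc 7])"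
        by (intro imageI) (simp only: set_map imageI)
      then show ?thesis by simp
    qed
  qed (simp_all only: set_upt set_map, auto)
  then have "set (map val primes_49) = set (filter prime [2..<Suc 49])" by (rule arg_cong)
  then show ?thesis by (simp only: set_filter_prime list.set_map)
qed

lemma primes_2221: "map val primes_2221 = filter prime [2..<Suc 2221]"
  unfolding primes_2221_def
proof (rule map_val_primes_among[where b = 49])
  show "val ` set primes_49 \<subseteq> {2..}"
    unfolding set_primes_49 using prime_ge_2_nat by blast
qed (simp_all only: set_upt set_primes_49, auto)

lemma set_primes_2221: "val ` set primes_2221 = {p. prime p \<and> p \<le> 2221}"
  using primes_2221 set_filter_prime[of 2221] by (metis list.set_map)

lemma primes_among_primes_2221:
  assumes "\<And>n. n \<in> set ns \<Longrightarrow> 2 \<le> n \<and> n < Suc 2221 * Suc 2221"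
  shows "map val (primes_among primes_2221 (map bits_of ns)) = filter prime ns"
proof (rule map_val_primes_among[OF _ _ assms])
  show "val ` set primes_2221 \<subseteq> {2..}"
    unfolding set_primes_2221 using prime_ge_2_nat by blast
qed (simp_all only: set_primes_2221, auto)

text \<open>Dropping the head removes the prime 2, and reversing gives the descending order.\<close>

lemma odd_primes_below_primes_2221: "odd_primes_below 2222 (rev (map val (tl primes_2221)))"
proof -
  have *: "filter prime [2..<Suc n] = 2 # filter prime [3..<Suc n]" if "2 \<le> n" for n
    using that upt_conv_Cons[of 2 "Suc n"] by (simp del: upt_Suc add: numeral_3_eq_3)
  have eq: "map val (tl primes_2221) = filter prime [3..<Suc 2221]"
    unfolding map_tl primes_2221 by (subst *) (simp, rule list.sel)
  have "prime p \<and> odd p \<and> p < 2222 \<longleftrightarrow> prime p \<and> 3 \<le> p \<and> p < Suc 2221" for p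
    using prime_odd_nat[of p] prime_ge_2_nat[of p] by (cases "p = 2") auto
  then have "set (filter prime [3..<Suc 2221]) = {p. prime p \<and> odd p \<and> p < 2222}"
    unfolding set_filter set_upt by auto
  moreover have "sorted_wrt (<) (filter prime [3..<Suc 2221])"
    by (intro sorted_wrt_filter sorted_wrt_upt)
  ultimately show ?thesis
    unfolding odd_primes_below_def eq sorted_wrt_rev set_rev by blast
qed

fun val_diff :: "bits \<times> bits \<Rightarrow> nat" where
  "val_diff (a, b) = val a - val b"

text \<open>The upper bound is \<open>2222 * 2222\<close>, up to which sifting by the primes below
  2222 leaves primes only.\<close>

lemma prime_count_legendre:
  assumes "2 \<le> n" "n < 4937284"
  shows "prime_count n
    = val_diff (legendre (rows (B1 Nil0) (tl primes_2221) []) (bits_of n) Nil0 Nil0)"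
proof -
  define t where "t = rows (B1 Nil0) (tl primes_2221) []"
  define ps where "ps = rev (map val (tl primes_2221))"
  obtain a b where ab: "legendre t (bits_of n) Nil0 Nil0 = (a, b)" by force
  have t: "is_table ps t"
    using is_table_rows[of "[]" "[]" "B1 Nil0" "tl primes_2221"] by (simp add: t_def ps_def)
  have ps: "odd_primes_below 2222 ps"
    using odd_primes_below_primes_2221 by (simp add: ps_def)
  have "val a = val b + card (sift ps n)"
    using legendre_correct[OF t ps _ ab] assms by simp
  moreover have "card (sift ps n) = prime_count n"
    by (rule card_sift_eq_prime_count[OF ps]) (use assms in simp)
  ultimately show ?thesis
    unfolding t_def[symmetric] ab by simp
qed

section \<open>Numerical values\<close>

lemma map_primes_49: "map val primes_49 = [2,3,5,7,11,13,17,19,23,29,31,37,41,43,47]"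
  by code_simp
text \<open>Positions are one less than the indices of the primes.\<close>

lemma nth_primes_2221:
  "length primes_2221 = 331"
  "map val (map ((!) primes_2221) [4, 14, 15, 16, 17, 328, 329, 330])
    = [11, 47, 53, 59, 61, 2207, 2213, 2221]"
  by code_simp+
text \<open>Here \<open>4870849 = 2207\<^sup>2\<close> is the end of the sixth block, and the
  interval pins down the last prime before it.\<close>

lemma primes_near_4870849:
  "map val (primes_among primes_2221 (map bits_of [4870843..<Suc 4870849])) = [4870843]"
  by code_simp
lemma legendre_4870849:
  "val_diff (legendre (rows (B1 Nil0) (tl primes_2221) []) (bits_of 4870849) Nil0 Nil0) = 340059"
  by code_simp

lemma nth_prime_val_nth:
  assumes "i < length primes_2221" shows "nth_prime (Suc i) = val (primes_2221 ! i)"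
proof -
  have "nth_prime (Suc i) = map val primes_2221 ! i"
  proof (rule nth_prime_nth)
    show "sorted_wrt (<) (map val primes_2221)"
      unfolding primes_2221 by (intro sorted_wrt_filter sorted_wrt_upt)
    show "set (map val primes_2221) = {p. prime p \<and> p \<le> 2221}"
      using set_primes_2221 by simp
    show "i < length (map val primes_2221)" using assms by simp
  qed
  then show ?thesis using assms by simp
qed

lemma nth_prime_values:
  "nth_prime 5 = 11" "nth_prime 15 = 47" "nth_prime 16 = 53" "nth_prime 17 = 59"
  "nth_prime 18 = 61" "nth_prime 329 = 2207" "nth_prime 330 = 2213" "nth_prime 331 = 2221"
  using nth_primes_2221 nth_prime_val_nth[of 4] nth_prime_val_nth[of 14] nth_prime_val_nth[of 15]
    nth_prime_val_nth[of 16] nth_prime_val_nth[of 17] nth_prime_val_nth[of 328]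
    nth_prime_val_nth[of 329] nth_prime_val_nth[of 330]
  by simp_all

lemma prime_count_eqI:
  assumes "1 \<le> k" "nth_prime k \<le> x" "x < nth_prime (k + 1)"
  shows "prime_count x = k"
  using nth_prime_le_iff[of k x] nth_prime_le_iff[of "k + 1" x] assms by simp

text \<open>Identifies the largest prime up to \<open>x\<close> by its index, which gives
  \<open>MpP 5\<close> without listing the block.\<close>

lemma le_nth_prime_count:
  assumes "prime q" "q \<le> x" shows "q \<le> nth_prime (prime_count x)"
proof -
  have q: "nth_prime (prime_count q) = q" by (rule nth_prime_eqI[OF assms(1) refl])
  have "1 \<le> prime_count q"
    using prime_count_less[OF assms(1), of 0] prime_gt_0_nat[OF assms(1)] by simp
  moreover have "prime_count q \<le> prime_count x" using assms(2) by (rule prime_count_mono)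
  ultimately show ?thesis
    using nth_prime_le_iff[of "prime_count q" "nth_prime (prime_count x)"]
      prime_count_nth_prime[of "prime_count x"] q by simp
qed

lemma prime_le_49_iff:
  fixes p :: nat
  assumes "p \<le> 49"
  shows "prime p \<longleftrightarrow> p \<in> set [2,3,5,7,11,13,17,19,23,29,31,37,41,43,47]"
proof -
  have "prime p \<longleftrightarrow> p \<in> val ` set primes_49"
    unfolding set_primes_49 using assms by simp
  then show ?thesis by (simp only: map_primes_49 flip: list.set_map)
qed

section \<open>The third to the sixth block\<close>

lemma pP_3: "pP 3 = {5, 7}" and MIpP_3: "MIpP 3 = 9"
proof -
  show M: "MIpP 3 = 9" using MIpP_Suc[of 2] by (simp add: MpP_2)
  have "pP 3 = {p. prime p \<and> 3 < p \<and> p \<le> 9}" using pP_Suc_eq[of 2] by (simp add: MIpP_2 M)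
  also have "\<dots> = {p \<in> set [2,3,5,7,11,13,17,19,23,29,31,37,41,43,47]. 3 < p \<and> p \<le> 9}"
    using prime_le_49_iff by fastforce
  also have "\<dots> = {5, 7}" by auto
  finally show "pP 3 = {5, 7}" .
qed

lemma pP_4: "pP 4 = {11, 13, 17, 19, 23, 29, 31, 37, 41, 43, 47}" and MIpP_4: "MIpP 4 = 49"
proof -
  show M: "MIpP 4 = 49" using MIpP_Suc[of 3] by (simp add: MpP_def pP_3)
  have "pP 4 = {p. prime p \<and> 9 < p \<and> p \<le> 49}" using pP_Suc_eq[of 3] by (simp add: MIpP_3 M)
  also have "\<dots> = {p \<in> set [2,3,5,7,11,13,17,19,23,29,31,37,41,43,47]. 9 < p}"
    using prime_le_49_iff by fastforce
  also have "\<dots> = {11, 13, 17, 19, 23, 29, 31, 37, 41, 43, 47}" by auto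
  finally show "pP 4 = {11, 13, 17, 19, 23, 29, 31, 37, 41, 43, 47}" .
qed

lemma prime_count_49: "prime_count 49 = 15"
  by (rule prime_count_eqI) (simp_all add: nth_prime_values)

lemma prime_count_2209: "prime_count 2209 = 329"
  by (rule prime_count_eqI) (simp_all add: nth_prime_values)

lemma prime_count_4870849: "prime_count 4870849 = 340059"
  using prime_count_legendre[of 4870849] legendre_4870849 by simp

lemma pP_5: "pP 5 = nth_prime ` {16..329}" and MpP_5: "MpP 5 = 2207" and MIpP_5: "MIpP 5 = 2209"
proof -
  show M: "MIpP 5 = 2209" using MIpP_Suc[of 4] by (simp add: MpP_def pP_4)
  have *: "pP 5 = {p. prime p \<and> 49 < p \<and> p \<le> 2209}"
    using pP_Suc_eq[of 4] by (simp add: MIpP_4 M)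
  then show "pP 5 = nth_prime ` {16..329}"
    using nth_prime_image[of 49 2209] by (simp add: prime_count_49 prime_count_2209)
  show "MpP 5 = 2207" unfolding MpP_def
  proof (rule Max_eqI)
    show "finite (pP 5)" unfolding * by (rule finite_subset[of _ "{..2209}"]) blast+
    show "2207 \<in> pP 5" unfolding * mem_Collect_eq
    proof (intro conjI)
      show "prime (2207 :: nat)" using prime_nth_prime[of 329] by (simp only: nth_prime_values)
    qed simp_all
    show "p \<le> 2207" if "p \<in> pP 5" for p
      using that le_nth_prime_count[of p 2209] unfolding * prime_count_2209 nth_prime_values
      by blast
  qed
qed

lemma pP_6: "pP 6 = nth_prime ` {330..340059}"
proof -
  have "MIpP 6 = 4870849" using MIpP_Suc[of 5] by (simp add: MpP_5)
  then have "pP 6 = {p. prime p \<and> 2209 < p \<and> p \<le> 4870849}"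
    using pP_Suc_eq[of 5] by (simp add: MIpP_5)
  then show ?thesis
    using nth_prime_image[of 2209 4870849] by (simp add: prime_count_2209 prime_count_4870849)
qed

text \<open>No prime lies beyond 4870843 and up to 4870849, so the counts at both numbers
  agree.\<close>

lemma nth_prime_340059: "nth_prime 340059 = 4870843"
proof (rule nth_prime_eqI)
  have "filter prime [4870843..<Suc 4870849]
      = map val (primes_among primes_2221 (map bits_of [4870843..<Suc 4870849]))"
    by (rule primes_among_primes_2221[symmetric]) (simp only: set_upt, auto)
  then have "filter prime [4870843..<Suc 4870849] = [4870843]"
    by (simp only: primes_near_4870849)
  then have "set (filter prime [4870843..<Suc 4870849]) = {4870843}"
    by (simp only: list.set)
  then have *: "prime p \<and> 4870843 \<le> p \<and> p < Suc 4870849 \<longleftrightarrow> p = 4870843" for p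
    unfolding set_filter set_upt by auto
  show "prime (4870843 :: nat)" using *[THEN iffD2, OF refl] by (rule conjunct1)
  have "prime p \<and> p \<le> 4870849 \<longleftrightarrow> prime p \<and> p \<le> 4870843" for p :: nat
    using *[of p] by linarith
  then show "prime_count 4870843 = 340059"
    using prime_count_4870849 by (simp only: prime_count_def)
qed

section \<open>Limits of increasing unions and the final assembly\<close>

lemma incseq_UN_atMost: "incseq (\<lambda>n. \<Union>j\<in>{k..n}. A j)" for k :: nat
  by (intro incseq_SucI UN_mono) auto

lemma set_lim_UN_atMost: "set_lim (\<lambda>n. \<Union>j\<in>{k..n}. A j) = (\<Union>j\<in>{k..}. A j)" for k :: nat
  unfolding set_lim_def by force

theorem theorem3p9:
  shows
    "(\<forall>i\<ge>2. pP (i + 1) = \<phi> {MIpP i + 1 .. (MpP i)\<^sup>2}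
        \<and> \<phi> {MIpP i + 1 .. (MpP i)\<^sup>2} = \<phi> {MIpP i + 2 .. (MpP i)\<^sup>2 - 2})
   \<and> (pP 1 = {2}
      \<and> pP 2 = {3}
      \<and> pP 3 = {5, 7}
      \<and> pP 4 = {11, 13, 17, 19, 23, 29, 31, 37, 41, 43, 47}
      \<and> nth_prime 5 = 11 \<and> nth_prime 15 = 47
      \<and> pP 5 = nth_prime ` {16..329}
      \<and> nth_prime 16 = 53 \<and> nth_prime 17 = 59 \<and> nth_prime 18 = 61
      \<and> nth_prime 329 = 2207 \<and> MpP 5 = 2207
      \<and> pP 6 = nth_prime ` {330..340059}
      \<and> nth_prime 330 = 2213 \<and> nth_prime 331 = 2221
      \<and> nth_prime 340059 = 4870843)
   \<and> ({p. prime p} = \<phi> {1..}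
      \<and> {p. prime p} = (\<Union>j\<in>{1..}. pP j)
      \<and> {p. prime p} = pP 1 \<union> pP 2 \<union> (\<Union>j\<in>{2..}. \<phi> {MIpP j + 1 .. (MpP j)\<^sup>2})
      \<and> {p. prime p} = pP 1 \<union> pP 2 \<union> (\<Union>j\<in>{2..}. \<phi> {MIpP j + 2 .. (MpP j)\<^sup>2 - 2})
      \<and> incseq (\<lambda>n. \<Union>j\<in>{2..n}. \<phi> {MIpP j + 2 .. (MpP j)\<^sup>2 - 2})
      \<and> {p. prime p} = pP 1 \<union> pP 2
            \<union> set_lim (\<lambda>n. \<Union>j\<in>{2..n}. \<phi> {MIpP j + 2 .. (MpP j)\<^sup>2 - 2}))
   \<and> (disjoint_family_on pP {1..} \<and> partition_on {p. prime p} (pP ` {1..}))"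
proof -
  have trim: "(\<Union>j\<in>{2..}. \<phi> {MIpP j + 1 .. (MpP j)\<^sup>2}) = (\<Union>j\<in>{2..}. \<phi> {MIpP j + 2 .. (MpP j)\<^sup>2 - 2})"
    by (intro SUP_cong refl primes_in_trim) simp
  have "{p. prime p} = \<phi> {1..}"
    unfolding primes_in_def using prime_ge_1_nat by auto
  moreover have "pP 1 = {2}" "pP 2 = {3}" by (simp_all add: numeral_2_eq_2)
  moreover have "\<forall>i\<ge>2. pP (i + 1) = \<phi> {MIpP i + 1 .. (MpP i)\<^sup>2}
        \<and> \<phi> {MIpP i + 1 .. (MpP i)\<^sup>2} = \<phi> {MIpP i + 2 .. (MpP i)\<^sup>2 - 2}"
    using pP_Suc primes_in_trim by blast
  moreover note pP_3 pP_4 pP_5 pP_6 MpP_5 nth_prime_values nth_prime_340059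
    UN_pP[symmetric] UN_pP_split UN_pP_split[unfolded trim] incseq_UN_atMost
    UN_pP_split[unfolded trim, folded set_lim_UN_atMost] disjoint_pP partition_pP
  ultimately show ?thesis by (intro conjI) assumption+
qed

end
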